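(* Let $m,n$ be positive integers, let $X=\mathbb{R}^{m\times n}\times\mathbb{R}^{m\times n}$ and $Y=\mathbb{R}^{(m-1)\times n}\times\mathbb{R}^{m\times(n-1)}\times\mathbb{R}^{(m-1)\times n}\times\mathbb{R}^{m\times(n-1)}$, let $C\subseteq X$ be a nonempty closed convex set, let $\mathbf{b}\in X$ and $\lambda>0$. Consider the primal problem $$\min_{\mathbf{x}\in X}\ \frac12\|\mathbf{x}-\mathbf{b}\|_F^2+\lambda\|\mathbf{x}\|_{\mathrm{TV1i}}+I_C(\mathbf{x}),\qquad (P)$$ where $\|\cdot\|_{\mathrm{TV1i}}$ is the type-I isotropic total variation seminorm. Let $S\subseteq Y$ be the set of all $\mathbf{q}=(\mathbf{r}^{(1)},\mathbf{r}^{(2)},\mathbf{s}^{(1)},\mathbf{s}^{(2)})\in Y$ satisfying $$\big(r^{(1)}_{j,k}\big)^2+\big(r^{(2)}_{j,k}\big)^2+\big(s^{(1)}_{j,k}\big)^2+\big(s^{(2)}_{j,k}\big)^2\le 1,\quad j=1,\dots,m-1,\ k=1,\dots,n-1,$$ $$\big(r^{(1)}_{j,n}\big)^2+\big(s^{(1)}_{j,n}\big)^2\le 1,\quad j=1,\dots,m-1,$$ $$\big(r^{(2)}_{m,k}\big)^2+\big(s^{(2)}_{m,k}\big)^2\le 1,\quad k=1,\dots,n-1.$$ Then the Lagrangian dual problem of $(P)$ is (up to a positive scaling factor, an additive constant, and the change from maximization to minimization) $$\min_{\mathbf{q}\in S}\Big\{h(\mathbf{q})\equiv-\big\|\mathcal{H}_C\big(\mathbf{b}-\lambda\mathcal{L}^T(\mathbf{q})\big)\big\|_F^2+\big\|\mathbf{b}-\lambda\mathcal{L}^T(\mathbf{q})\big\|_F^2\Big\};\qquad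 (D)$$ that is, there are constants $a>0$ and $c\in\mathbb{R}$, independent of $\mathbf{q}$, such that the Lagrange dual function $g$ of $(P)$ satisfies $g(\mathbf{q})=c-a\,h(\mathbf{q})$ for $\mathbf{q}\in S$ and $g(\mathbf{q})=-\infty$ for $\mathbf{q}\in Y\setminus S$. In addition, if $\mathbf{x}^\star$ is the optimal solution of $(P)$ and $\mathbf{q}^\star$ is an optimal solution of $(D)$, then $$\mathbf{x}^\star=\mathcal{P}_C\big(\mathbf{b}-\lambda\mathcal{L}^T(\mathbf{q}^\star)\big).$$
   Context: A complex image in $\mathbb{C}^{m\times n}$ is identified with the pair $\mathbf{x}=(\mathbf{u},\mathbf{v})\in X=\mathbb{R}^{m\times n}\times\mathbb{R}^{m\times n}$ of its real and imaginary parts. $X$ and $Y$ carry the standard Euclidean inner product $\langle\cdot,\cdot\rangle$ (sum of products of all entries); in particular $\|(\mathbf{u},\mathbf{v})\|_F=\sqrt{\|\mathbf{u}\|_F^2+\|\mathbf{v}\|_F^2}$. Finite differences: $\mathcal{L}:X\to Y$ is the linear map $\mathcal{L}(\mathbf{u},\mathbf{v})=(\mathbf{u}^{(1)},\mathbf{u}^{(2)},\mathbf{v}^{(1)},\mathbf{v}^{(2)})$, where $u^{(1)}_{j,k}=u_{j,k}-u_{j+1,k}$ for $1\le j\le m-1$, $1\le k\le n$; $u^{(2)}_{j,k}=u_{j,k}-u_{j,k+1}$ for $1\le j\le m$, $1\le k\le n-1$; and $\mathbf{v}^{(1)},\mathbf{v}^{(2)}$ are defined in the same way from $\mathbf{v}$.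 $\mathcal{L}^T:Y\to X$ denotes the adjoint of $\mathcal{L}$. For $\mathbf{p}=(\mathbf{u}^{(1)},\mathbf{u}^{(2)},\mathbf{v}^{(1)},\mathbf{v}^{(2)})\in Y$ (arbitrary matrices of the appropriate sizes) put $$f(\mathbf{p})=\sum_{j=1}^{m-1}\sum_{k=1}^{n-1}\sqrt{(u^{(1)}_{j,k})^2+(v^{(1)}_{j,k})^2+(u^{(2)}_{j,k})^2+(v^{(2)}_{j,k})^2}+\sum_{j=1}^{m-1}\sqrt{(u^{(1)}_{j,n})^2+(v^{(1)}_{j,n})^2}+\sum_{k=1}^{n-1}\sqrt{(u^{(2)}_{m,k})^2+(v^{(2)}_{m,k})^2}.$$ The type-I isotropic total variation of $\mathbf{x}\in X$ is $\|\mathbf{x}\|_{\mathrm{TV1i}}=f(\mathcal{L}(\mathbf{x}))$. $I_C$ is the indicator function of $C$ ($0$ on $C$, $+\infty$ off $C$); $\mathcal{P}_C$ is the Euclidean projection onto $C$; $\mathcal{H}_C(\mathbf{x})=\mathbf{x}-\mathcal{P}_C(\mathbf{x})$. Lagrangian dual: $(P)$ is equivalently written as the problem of minimizing $\frac{1}{2\lambda}\|\mathbf{x}-\mathbf{b}\|_F^2+I_C(\mathbf{x})+f(\mathbf{p})$ over $(\mathbf{x},\mathbf{p})\in X\times Y$ subject to $\mathbf{p}=\mathcal{L}(\mathbf{x})$. With dual variable $\mathbf{q}\in Y$, the Lagrangian is $$L(\mathbf{x},\mathbf{p},\mathbf{q})=\frac{1}{2\lambda}\|\mathbf{x}-\mathbf{b}\|_F^2+I_C(\mathbf{x})+f(\mathbf{p})+\langle\mathbf{q},\mathcal{L}(\mathbf{x})-\mathbf{p}\rangle,$$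 the Lagrange dual function is $g(\mathbf{q})=\inf_{\mathbf{x}\in X,\,\mathbf{p}\in Y}L(\mathbf{x},\mathbf{p},\mathbf{q})$, and the Lagrangian dual problem is to maximize $g$ over $Y$. *)

theory Defs
  imports "HOL-Analysis.Analysis"
begin

text \<open>
  The row and column indices \<open>1, \<dots>, m\<close> and \<open>1, \<dots>, n\<close> are represented by finite linearly
  ordered types \<open>'m\<close> and \<open>'n\<close>; thus \<open>m = CARD('m) \<ge> 1\<close> and \<open>n = CARD('n) \<ge> 1\<close> are
  arbitrary, and the order identifies each type with the corresponding index range.
\<close>

definition last_ix :: "'a::{finite,linorder}" where
  "last_ix = Max UNIV"

text \<open>The successor is used only for \<open>j < last_ix\<close>.\<close>

definition next_ix :: "'a::{finite,linorder} \<Rightarrow> 'a" where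
  "next_ix j = Min {i. j < i}"

lemma le_last_ix: "j \<le> last_ix"
  by (simp add: last_ix_def)

lemma card_lessThan_last_ix:
  "Suc (card {..<last_ix :: 'a::{finite,linorder}}) = CARD('a)"
proof -
  have "(UNIV :: 'a set) = insert last_ix {..<last_ix}"
    using le_last_ix order_le_imp_less_or_eq by auto
  then show ?thesis
    by (metis card_insert_disjoint finite_code lessThan_iff less_irrefl)
qed

lemma lessThan_next_ix:
  fixes j :: "'a::{finite,linorder}"
  assumes "j < last_ix"
  shows "{..<next_ix j} = {..j}"
proof -
  have "{i. j < i} \<noteq> {}"
    using assms by blast
  then have "i < next_ix j \<longleftrightarrow> i \<le> j" for i
    unfolding next_ix_def by (subst Min_gr_iff) (auto simp: not_less[symmetric])
  then show ?thesis
    by auto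
qed

text \<open>
  On \<open>img\<close> and \<open>grad\<close>, the library inner product and norm are the sum of products of
  all entries and the Frobenius norm. A matrix \<open>u\<close> has entries
  \<open>u $ j $ k\<close> with row index \<open>j\<close> and column index \<open>k\<close>.
\<close>

type_synonym ('m, 'n) rmat = "real ^ 'n ^ 'm"

type_synonym ('m, 'n) img = "('m, 'n) rmat \<times> ('m, 'n) rmat"

type_synonym ('m, 'n) grad =
  "('m, 'n) rmat \<times> ('m, 'n) rmat \<times> ('m, 'n) rmat \<times> ('m, 'n) rmat"

text \<open>
  The space \<open>Y\<close>: an \<open>(m - 1) \<times> n\<close> matrix is an \<open>m \<times> n\<close> matrix whose last row is zero, an
  \<open>m \<times> (n - 1)\<close> matrix is one whose last column is zero. (Types are nonempty, so the case
  \<open>m = 1\<close> or \<open>n = 1\<close> excludes genuine index types of size \<open>m - 1\<close>, \<open>n - 1\<close>.) The padding does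
  not change inner products or norms.
\<close>

definition grad_space :: "('m::{finite,linorder}, 'n::{finite,linorder}) grad set" where
  "grad_space = {(r1, r2, s1, s2).
     (\<forall>k. r1 $ last_ix $ k = 0) \<and> (\<forall>j. r2 $ j $ last_ix = 0) \<and>
     (\<forall>k. s1 $ last_ix $ k = 0) \<and> (\<forall>j. s2 $ j $ last_ix = 0)}"

definition row_diff :: "('m::{finite,linorder}, 'n::finite) rmat \<Rightarrow> ('m, 'n) rmat" where
  "row_diff u = (\<chi> j k. if j < last_ix then u $ j $ k - u $ next_ix j $ k else 0)"

definition col_diff :: "('m::finite, 'n::{finite,linorder}) rmat \<Rightarrow> ('m, 'n) rmat" where
  "col_diff u = (\<chi> j k. if k < last_ix then u $ j $ k - u $ j $ next_ix k else 0)"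

definition fin_diff ::
  "('m, 'n) img \<Rightarrow> ('m::{finite,linorder}, 'n::{finite,linorder}) grad" where
  "fin_diff = (\<lambda>(u, v). (row_diff u, col_diff u, row_diff v, col_diff v))"

lemma fin_diff_in_grad_space: "fin_diff x \<in> grad_space"
  by (simp add: fin_diff_def grad_space_def row_diff_def col_diff_def split: prod.splits)

text \<open>
  Hence \<open>adjoint fin_diff\<close> is the genuine adjoint; on \<open>grad_space\<close> it is the adjoint
  \<open>Y \<rightarrow> X\<close> of the finite difference map viewed as \<open>X \<rightarrow> Y\<close>.
\<close>

lemma linear_fin_diff: "linear fin_diff"
  by (rule linearI)
    (auto simp: fin_diff_def row_diff_def col_diff_def vec_eq_iff algebra_simps
      split: prod.splits)

lemma inner_adjoint_fin_diff: "x \<bullet> adjoint fin_diff q = fin_diff x \<bullet> q"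
  using adjoint_works[OF linear_fin_diff] .

definition tv_fun :: "('m::{finite,linorder}, 'n::{finite,linorder}) grad \<Rightarrow> real" where
  "tv_fun = (\<lambda>(u1, u2, v1, v2).
     (\<Sum>j\<in>{..<last_ix}. \<Sum>k\<in>{..<last_ix}.
        sqrt ((u1 $ j $ k)\<^sup>2 + (v1 $ j $ k)\<^sup>2 + (u2 $ j $ k)\<^sup>2 + (v2 $ j $ k)\<^sup>2))
     + (\<Sum>j\<in>{..<last_ix}. sqrt ((u1 $ j $ last_ix)\<^sup>2 + (v1 $ j $ last_ix)\<^sup>2))
     + (\<Sum>k\<in>{..<last_ix}. sqrt ((u2 $ last_ix $ k)\<^sup>2 + (v2 $ last_ix $ k)\<^sup>2)))"

definition tv1i :: "('m::{finite,linorder}, 'n::{finite,linorder}) img \<Rightarrow> real" where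
  "tv1i x = tv_fun (fin_diff x)"

definition indicator_fun :: "'a set \<Rightarrow> 'a \<Rightarrow> ereal" where
  "indicator_fun C x = (if x \<in> C then 0 else \<infinity>)"

definition proj_residual :: "'a::euclidean_space set \<Rightarrow> 'a \<Rightarrow> 'a" where
  "proj_residual C x = x - closest_point C x"

definition primal_obj ::
  "('m::{finite,linorder}, 'n::{finite,linorder}) img set \<Rightarrow> ('m, 'n) img \<Rightarrow> real
    \<Rightarrow> ('m, 'n) img \<Rightarrow> ereal" where
  "primal_obj C b lam x =
     ereal (1/2 * (norm (x - b))\<^sup>2) + ereal (lam * tv1i x) + indicator_fun C x"

definition lagrangian ::
  "('m::{finite,linorder}, 'n::{finite,linorder}) img set \<Rightarrow> ('m, 'n) img \<Rightarrow> real
    \<Rightarrow> ('m, 'n) img \<Rightarrow> ('m, 'n) grad \<Rightarrow> ('m, 'n) grad \<Rightarrow> ereal" where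
  "lagrangian C b lam x p q =
     ereal (1 / (2 * lam) * (norm (x - b))\<^sup>2) + indicator_fun C x
     + ereal (tv_fun p) + ereal (q \<bullet> (fin_diff x - p))"

definition lagrange_dual_fun ::
  "('m::{finite,linorder}, 'n::{finite,linorder}) img set \<Rightarrow> ('m, 'n) img \<Rightarrow> real
    \<Rightarrow> ('m, 'n) grad \<Rightarrow> ereal" where
  "lagrange_dual_fun C b lam q = (INF x. INF p\<in>grad_space. lagrangian C b lam x p q)"

definition dual_feasible :: "('m::{finite,linorder}, 'n::{finite,linorder}) grad set" where
  "dual_feasible = {(r1, r2, s1, s2) \<in> grad_space.
     (\<forall>j<last_ix. \<forall>k<last_ix.
        (r1 $ j $ k)\<^sup>2 + (r2 $ j $ k)\<^sup>2 + (s1 $ j $ k)\<^sup>2 + (s2 $ j $ k)\<^sup>2 \<le> 1) \<and>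
     (\<forall>j<last_ix. (r1 $ j $ last_ix)\<^sup>2 + (s1 $ j $ last_ix)\<^sup>2 \<le> 1) \<and>
     (\<forall>k<last_ix. (r2 $ last_ix $ k)\<^sup>2 + (s2 $ last_ix $ k)\<^sup>2 \<le> 1)}"

definition dual_obj ::
  "('m::{finite,linorder}, 'n::{finite,linorder}) img set \<Rightarrow> ('m, 'n) img \<Rightarrow> real
    \<Rightarrow> ('m, 'n) grad \<Rightarrow> real" where
  "dual_obj C b lam q =
     - (norm (proj_residual C (b - lam *\<^sub>R adjoint fin_diff q)))\<^sup>2
     + (norm (b - lam *\<^sub>R adjoint fin_diff q))\<^sup>2"

end

theory Submission
  imports Defs
begin

text \<open>
  On the gradient space the total variation is the sum over all pixels of the Euclidean norm of
  the four difference components, so it is the support function of the dual feasible set. Completing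
  the square at \<open>z q = b - lam *\<^sub>R adjoint fin_diff q\<close> turns the Lagrangian into the squared
  distance from \<open>x\<close> to \<open>z q\<close> plus a constant, which gives the dual function. For the second part,
  \<open>dual_obj q\<close> is the maximum over \<open>x \<in> C\<close> of \<open>2 (z q \<bullet> x) - x \<bullet> x\<close>, attained at the projection
  of \<open>z q\<close>. First-order optimality of \<open>q\<close> therefore says that \<open>q\<close> maximises the inner product with
  \<open>fin_diff y\<close> over the feasible set, \<open>y\<close> being the projection of \<open>z q\<close>; hence
  \<open>q \<bullet> fin_diff y = tv1i y\<close>, the duality gap vanishes at \<open>y\<close>, and \<open>y\<close> is the unique primal
  minimiser.
\<close>

section \<open>Gradient fields seen pixel by pixel\<close>

definition pixel :: "('m::finite, 'n::finite) grad \<Rightarrow> 'm \<Rightarrow> 'n \<Rightarrow> real \<times> real \<times> real \<times> real" where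
  "pixel = (\<lambda>(r1, r2, s1, s2) j k. (r1 $ j $ k, r2 $ j $ k, s1 $ j $ k, s2 $ j $ k))"

text \<open>Both witnesses needed below, a maximiser over the dual feasible set and a separating
  direction, are pixelwise rescalings of a given field. Rescaling keeps the padding zero.\<close>

definition pixel_scale ::
  "('m \<Rightarrow> 'n \<Rightarrow> real) \<Rightarrow> ('m::finite, 'n::finite) grad \<Rightarrow> ('m, 'n) grad" where
  "pixel_scale c = (\<lambda>(r1, r2, s1, s2).
     (\<chi> j k. c j k * r1 $ j $ k, \<chi> j k. c j k * r2 $ j $ k,
      \<chi> j k. c j k * s1 $ j $ k, \<chi> j k. c j k * s2 $ j $ k))"

lemma pixel_pixel_scale: "pixel (pixel_scale c p) j k = c j k *\<^sub>R pixel p j k"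
  by (simp add: pixel_def pixel_scale_def split: prod.splits)

lemma pixel_scaleR: "pixel (t *\<^sub>R p) j k = t *\<^sub>R pixel p j k"
  by (simp add: pixel_def split: prod.splits)

lemma pixel_add: "pixel (p + q) j k = pixel p j k + pixel q j k"
  by (simp add: pixel_def split: prod.splits)

lemma norm_pixel:
  "norm (pixel (r1, r2, s1, s2) j k) =
     sqrt ((r1 $ j $ k)\<^sup>2 + (r2 $ j $ k)\<^sup>2 + (s1 $ j $ k)\<^sup>2 + (s2 $ j $ k)\<^sup>2)"
  by (simp add: pixel_def norm_Pair add.assoc)

lemma inner_grad: "p \<bullet> q = (\<Sum>j\<in>UNIV. \<Sum>k\<in>UNIV. pixel p j k \<bullet> pixel q j k)"
  by (simp add: pixel_def inner_vec_def sum.distrib split: prod.splits)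

lemma pixel_scale_in_grad_space: "p \<in> grad_space \<Longrightarrow> pixel_scale c p \<in> grad_space"
  by (auto simp: grad_space_def pixel_scale_def)

lemma subspace_grad_space: "subspace grad_space"
  by (auto simp: subspace_def grad_space_def zero_prod_def)

lemma UNIV_last_ix: "(UNIV :: 'a::{finite,linorder} set) = insert last_ix {..<last_ix}"
  using le_last_ix order_le_imp_less_or_eq by auto

lemma all_ix2_iff:
  "(\<forall>j k. P j k) \<longleftrightarrow> (\<forall>j<last_ix. \<forall>k<last_ix. P j k) \<and>
     (\<forall>j<last_ix. P j last_ix) \<and> (\<forall>k<last_ix. P last_ix k) \<and> P last_ix last_ix"
  by (metis le_last_ix order_le_imp_less_or_eq)

text \<open>The zero padding merges the three sums: in the last row or column two components vanish,
  and the corner pixel contributes nothing.\<close>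

lemma tv_fun_eq:
  assumes "p \<in> grad_space"
  shows "tv_fun p = (\<Sum>j\<in>UNIV. \<Sum>k\<in>UNIV. norm (pixel p j k))"
proof -
  obtain u1 u2 v1 v2 where p: "p = (u1, u2, v1, v2)"
    by (cases p) auto
  show ?thesis
    using assms unfolding p grad_space_def
    by (simp add: UNIV_last_ix norm_pixel tv_fun_def sum.distrib add_ac)
qed

lemma dual_feasible_eq: "dual_feasible = {q \<in> grad_space. \<forall>j k. norm (pixel q j k) \<le> 1}"
  unfolding all_ix2_iff[of "\<lambda>j k. norm (pixel _ j k) \<le> 1"]
  by (auto simp: dual_feasible_def grad_space_def norm_pixel)

lemma zero_in_grad_space: "0 \<in> grad_space"
  by (rule subspace_0[OF subspace_grad_space])

section \<open>Total variation as a support function\<close>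

lemma tv_fun_0: "tv_fun 0 = 0"
  by (simp add: tv_fun_def zero_prod_def)

lemma tv_fun_scaleR:
  assumes "p \<in> grad_space" "t \<ge> 0"
  shows "tv_fun (t *\<^sub>R p) = t * tv_fun p"
  using assms subspace_scale[OF subspace_grad_space, of p t]
  by (simp add: tv_fun_eq pixel_scaleR sum_distrib_left)

lemma convex_dual_feasible: "convex dual_feasible"
proof -
  have "convex {q \<in> grad_space. \<forall>j k. norm (pixel q j k) \<le> 1}"
  proof (rule convexI)
    fix p q :: "('m::{finite,linorder}, 'n::{finite,linorder}) grad" and s t :: real
    assume *: "p \<in> {q \<in> grad_space. \<forall>j k. norm (pixel q j k) \<le> 1}"
      "q \<in> {q \<in> grad_space. \<forall>j k. norm (pixel q j k) \<le> 1}" "0 \<le> s" "0 \<le> t" "s + t = 1"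
    have "s *\<^sub>R p + t *\<^sub>R q \<in> grad_space"
      using * subspace_grad_space by (auto intro: subspace_add subspace_scale)
    moreover have "norm (pixel (s *\<^sub>R p + t *\<^sub>R q) j k) \<le> 1" for j k
    proof -
      have "pixel p j k \<in> cball 0 1" "pixel q j k \<in> cball 0 1"
        using * by auto
      then have "s *\<^sub>R pixel p j k + t *\<^sub>R pixel q j k \<in> cball 0 1"
        using * convexD[OF convex_cball] by blast
      then show ?thesis
        by (simp add: pixel_add pixel_scaleR)
    qed
    ultimately show "s *\<^sub>R p + t *\<^sub>R q \<in> {q \<in> grad_space. \<forall>j k. norm (pixel q j k) \<le> 1}"
      by blast
  qed
  then show ?thesis
    by (simp add: dual_feasible_eq)
qed

lemma inner_le_tv_fun:
  assumes "q \<in> dual_feasible" "p \<in> grad_space"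
  shows "q \<bullet> p \<le> tv_fun p"
  unfolding inner_grad tv_fun_eq[OF assms(2)]
proof (intro sum_mono)
  fix j k
  have "pixel q j k \<bullet> pixel p j k \<le> norm (pixel q j k) * norm (pixel p j k)"
    by (rule norm_cauchy_schwarz)
  also have "\<dots> \<le> 1 * norm (pixel p j k)"
    using assms(1) by (intro mult_right_mono) (auto simp: dual_feasible_eq)
  finally show "pixel q j k \<bullet> pixel p j k \<le> norm (pixel p j k)"
    by simp
qed

lemma sgn_inner_self: "sgn v \<bullet> v = norm v" for v :: "'a::real_inner"
  by (cases "v = 0") (simp_all add: sgn_div_norm dot_square_norm power2_eq_square)

lemma tv_fun_attained:
  assumes "p \<in> grad_space"
  obtains q where "q \<in> dual_feasible" "q \<bullet> p = tv_fun p"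
proof
  \<comment> \<open>As \<open>inverse 0 = 0\<close>, this normalises nonzero pixels and leaves zero
    pixels at zero, so every norm is at most 1.\<close>
  let ?q = "pixel_scale (\<lambda>j k. inverse (norm (pixel p j k))) p"
  have pixel: "pixel ?q j k = sgn (pixel p j k)" for j k
    by (simp add: pixel_pixel_scale sgn_div_norm)
  show "?q \<in> dual_feasible"
    using pixel_scale_in_grad_space[OF assms] by (simp add: dual_feasible_eq pixel norm_sgn)
  show "?q \<bullet> p = tv_fun p"
    unfolding inner_grad tv_fun_eq[OF assms] pixel by (simp only: sgn_inner_self)
qed

lemma tv_fun_separates:
  assumes "q \<in> grad_space - dual_feasible"
  obtains p where "p \<in> grad_space" "q \<bullet> p > tv_fun p"
proof -
  obtain i l where il: "norm (pixel q i l) > 1"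
    using assms by (auto simp: dual_feasible_eq not_le)
  \<comment> \<open>Keep only a violating pixel of \<open>q\<close>, of norm c > 1: then
    \<open>tv_fun\<close> gives c while the inner product gives c * c.\<close>
  let ?p = "pixel_scale (\<lambda>j k. if j = i \<and> k = l then 1 else 0) q"
  have p: "?p \<in> grad_space"
    using assms by (simp add: pixel_scale_in_grad_space)
  \<comment> \<open>The test on \<open>k\<close> stands outermost so that the inner sum over
    \<open>k\<close> collapses first, then the sum over \<open>j\<close>.\<close>
  have pixel: "pixel ?p j k = (if k = l then if j = i then pixel q i l else 0 else 0)" for j k
    by (simp add: pixel_pixel_scale)
  have "tv_fun ?p = norm (pixel q i l)"
    unfolding tv_fun_eq[OF p] pixel by (simp add: if_distrib[of norm] cong: if_cong)
  moreover have "q \<bullet> ?p = norm (pixel q i l) * norm (pixel q i l)"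
  proof -
    have "pixel q j k \<bullet> (if k = l then if j = i then pixel q i l else 0 else 0)
        = (if k = l then if j = i then (norm (pixel q i l))\<^sup>2 else 0 else 0)" for j k
      by (simp add: dot_square_norm)
    then show ?thesis
      unfolding inner_grad pixel by (simp add: power2_eq_square)
  qed
  moreover have "norm (pixel q i l) < norm (pixel q i l) * norm (pixel q i l)"
    using mult_strict_right_mono[OF il, of "norm (pixel q i l)"] il by linarith
  ultimately show ?thesis
    using p by (intro that[of ?p]) simp_all
qed

section \<open>The Lagrange dual function\<close>

lemma norm_diff_square_complete:
  fixes x b d :: "'a::real_inner"
  shows "(norm (x - b))\<^sup>2 + 2 * (x \<bullet> d) = (norm (x - (b - d)))\<^sup>2 + (norm b)\<^sup>2 - (norm (b - d))\<^sup>2"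
  by (simp add: power2_norm_eq_inner inner_diff inner_commute)

text \<open>Decouples the variables: for fixed \<open>q\<close>, one summand depends on
  \<open>x\<close> alone and the other on \<open>p\<close> alone, so the two infima can be treated
  separately.\<close>

lemma lagrangian_eq:
  fixes b :: "('m::{finite,linorder}, 'n::{finite,linorder}) img"
  assumes "lam > 0" "x \<in> C" "z = b - lam *\<^sub>R adjoint fin_diff q"
  shows "lagrangian C b lam x p q =
    ereal (((norm (x - z))\<^sup>2 + (norm b)\<^sup>2 - (norm z)\<^sup>2) / (2 * lam) + (tv_fun p - q \<bullet> p))"
proof -
  have "(norm (x - b))\<^sup>2 + 2 * lam * (q \<bullet> fin_diff x) = (norm (x - z))\<^sup>2 + (norm b)\<^sup>2 - (norm z)\<^sup>2"
    using norm_diff_square_complete[of x b "lam *\<^sub>R adjoint fin_diff q"]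
    by (simp add: assms(3) inner_adjoint_fin_diff inner_commute)
  then have "1 / (2 * lam) * (norm (x - b))\<^sup>2 + q \<bullet> fin_diff x
      = ((norm (x - z))\<^sup>2 + (norm b)\<^sup>2 - (norm z)\<^sup>2) / (2 * lam)"
    using assms(1) by (simp add: field_simps)
  then show ?thesis
    using assms(2) by (simp add: lagrangian_def indicator_fun_def inner_diff_right)
qed

lemma lagrange_dual_fun_feasible:
  fixes b :: "('m::{finite,linorder}, 'n::{finite,linorder}) img"
  assumes "C \<noteq> {}" "closed C" "lam > 0" "q \<in> dual_feasible"
  shows "lagrange_dual_fun C b lam q =
    ereal ((norm b)\<^sup>2 / (2 * lam) - 1 / (2 * lam) * dual_obj C b lam q)"
    (is "_ = ereal ?v")
proof -
  define z where "z = b - lam *\<^sub>R adjoint fin_diff q"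
  define y where "y = closest_point C z"
  have y: "y \<in> C"
    using assms closest_point_in_set by (simp add: y_def)
  have v: "?v = ((norm (y - z))\<^sup>2 + (norm b)\<^sup>2 - (norm z)\<^sup>2) / (2 * lam)"
    using assms(3)
    by (simp add: dual_obj_def proj_residual_def y_def z_def field_simps norm_minus_commute)
  show ?thesis
    unfolding lagrange_dual_fun_def
  proof (rule antisym)
    show "(INF x. INF p\<in>grad_space. lagrangian C b lam x p q) \<le> ereal ?v"
      \<comment> \<open>The infimum is attained at the projection \<open>y\<close> and at
        \<open>p = 0\<close>.\<close>
      by (rule INF_lower2[of y], simp, rule INF_lower2[of 0])
        (simp_all only: zero_in_grad_space lagrangian_eq[OF assms(3) y z_def] tv_fun_0 v
          inner_zero_right diff_zero add_0_right order_refl)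
    show "ereal ?v \<le> (INF x. INF p\<in>grad_space. lagrangian C b lam x p q)"
    proof (intro INF_greatest)
      fix x and p :: "('m, 'n) grad"
      assume p: "p \<in> grad_space"
      show "ereal ?v \<le> lagrangian C b lam x p q"
      proof (cases "x \<in> C")
        case True
        have "norm (y - z) \<le> norm (x - z)"
          using closest_point_le[OF assms(2) True, of z]
          by (simp add: y_def dist_norm norm_minus_commute)
        then have "(norm (y - z))\<^sup>2 \<le> (norm (x - z))\<^sup>2"
          by simp
        then have "?v \<le> ((norm (x - z))\<^sup>2 + (norm b)\<^sup>2 - (norm z)\<^sup>2) / (2 * lam)"
          using assms(3) unfolding v by (intro divide_right_mono) auto
        then show ?thesis
          using inner_le_tv_fun[OF assms(4) p]
          unfolding lagrangian_eq[OF assms(3) True z_def] by simp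
      next
        case False
        then show ?thesis
          by (simp add: lagrangian_def indicator_fun_def)
      qed
    qed
  qed
qed

text \<open>Along the ray through a separating \<open>p\<close>, positive homogeneity of
  \<open>tv_fun\<close> drives the Lagrangian to minus infinity.\<close>

lemma lagrange_dual_fun_infeasible:
  fixes b :: "('m::{finite,linorder}, 'n::{finite,linorder}) img"
  assumes "C \<noteq> {}" "lam > 0" "q \<in> grad_space - dual_feasible"
  shows "lagrange_dual_fun C b lam q = - \<infinity>"
proof (rule ereal_bot)
  fix B :: real
  obtain x where x: "x \<in> C"
    using assms(1) by blast
  obtain p where p: "p \<in> grad_space" "q \<bullet> p > tv_fun p"
    using tv_fun_separates[OF assms(3)] .
  define z where "z = b - lam *\<^sub>R adjoint fin_diff q"
  define A where "A = ((norm (x - z))\<^sup>2 + (norm b)\<^sup>2 - (norm z)\<^sup>2) / (2 * lam)"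
  \<comment> \<open>Solves \<open>A - t * (q \<bullet> p - tv_fun p) \<le> B\<close>; the maximum
    with 0 keeps \<open>t\<close> nonnegative, as homogeneity requires.\<close>
  define t where "t = max 0 ((A - B) / (q \<bullet> p - tv_fun p))"
  have "t \<ge> (A - B) / (q \<bullet> p - tv_fun p)"
    by (simp add: t_def)
  then have "A - B \<le> t * (q \<bullet> p - tv_fun p)"
    using p(2) by (simp add: pos_divide_le_eq)
  moreover have "tv_fun (t *\<^sub>R p) - q \<bullet> (t *\<^sub>R p) = - t * (q \<bullet> p - tv_fun p)"
    using p(1) by (simp add: tv_fun_scaleR t_def algebra_simps)
  ultimately have "lagrangian C b lam x (t *\<^sub>R p) q \<le> ereal B"
    by (simp add: lagrangian_eq[OF assms(2) x z_def] A_def)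
  moreover have "t *\<^sub>R p \<in> grad_space"
    by (rule subspace_scale[OF subspace_grad_space p(1)])
  ultimately show "lagrange_dual_fun C b lam q \<le> ereal B"
    unfolding lagrange_dual_fun_def by (intro INF_lower2[of x] INF_lower2[of "t *\<^sub>R p"]) auto
qed

section \<open>Optimality in the dual and recovery of the primal solution\<close>

text \<open>The point \<open>x\<close> competes with the projection for the distance to
  \<open>C\<close>. The bound is affine in \<open>q\<close>, so it serves as a supporting function
  and no derivative of \<open>dual_obj\<close> is taken.\<close>

lemma dual_obj_ge:
  fixes b :: "('m::{finite,linorder}, 'n::{finite,linorder}) img"
  assumes "closed C" "x \<in> C"
  shows "dual_obj C b lam q \<ge> 2 * ((b - lam *\<^sub>R adjoint fin_diff q) \<bullet> x) - x \<bullet> x"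
proof -
  let ?z = "b - lam *\<^sub>R adjoint fin_diff q"
  have "(norm (?z - closest_point C ?z))\<^sup>2 \<le> (norm (?z - x))\<^sup>2"
    using closest_point_le[OF assms, of ?z] by (simp add: dist_norm)
  also have "\<dots> = (norm ?z)\<^sup>2 - 2 * (?z \<bullet> x) + x \<bullet> x"
    by (simp add: power2_norm_eq_inner inner_diff inner_commute)
  finally show ?thesis
    by (simp add: dual_obj_def proj_residual_def)
qed

lemma dual_obj_eq:
  assumes "z = b - lam *\<^sub>R adjoint fin_diff q"
  shows "dual_obj C b lam q = 2 * (z \<bullet> closest_point C z) - closest_point C z \<bullet> closest_point C z"
  unfolding dual_obj_def proj_residual_def assms[symmetric]
  by (simp add: power2_norm_eq_inner inner_diff inner_commute)

text \<open>On the segment from \<open>q\<close> to \<open>r\<close>, the affine minorant given by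
  \<open>y t\<close> is exact at \<open>w t\<close> and at most \<open>dual_obj\<close> at
  \<open>q\<close>. Minimality of \<open>q\<close> thus forbids it to decrease from \<open>q\<close>
  to \<open>w t\<close>; dividing by \<open>lam * t\<close> gives the inequality at
  \<open>y t\<close>.\<close>

lemma dual_minimiser_first_order:
  fixes b :: "('m::{finite,linorder}, 'n::{finite,linorder}) img"
  assumes "C \<noteq> {}" "closed C" "convex C" "lam > 0"
    and min: "is_arg_min (dual_obj C b lam) (\<lambda>q. q \<in> dual_feasible) q"
    and r: "r \<in> dual_feasible"
  shows "(r - q) \<bullet> fin_diff (closest_point C (b - lam *\<^sub>R adjoint fin_diff q)) \<le> 0"
proof -
  define z where "z s = b - lam *\<^sub>R adjoint fin_diff s" for s :: "('m, 'n) grad"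
  define w where "w t = q + t *\<^sub>R (r - q)" for t
  define y where "y t = closest_point C (z (w t))" for t
  have lin: "linear (adjoint (fin_diff :: ('m, 'n) img \<Rightarrow> _))"
    by (rule adjoint_linear[OF linear_fin_diff])
  have q: "q \<in> dual_feasible"
    using min by (simp add: is_arg_min_def)
  have le: "(r - q) \<bullet> fin_diff (y t) \<le> 0" if t: "0 < t" "t \<le> 1" for t
  proof -
    have "w t = (1 - t) *\<^sub>R q + t *\<^sub>R r"
      by (simp add: w_def algebra_simps)
    then have "w t \<in> dual_feasible"
      using convexD[OF convex_dual_feasible q r, of "1 - t" t] t by simp
    then have "dual_obj C b lam q \<le> dual_obj C b lam (w t)"
      using min unfolding is_arg_min_linorder by blast
    moreover have "dual_obj C b lam (w t) = 2 * (z (w t) \<bullet> y t) - y t \<bullet> y t"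
      unfolding y_def by (rule dual_obj_eq) (simp add: z_def)
    moreover have "y t \<in> C"
      unfolding y_def using assms(1,2) by (simp add: closest_point_in_set)
    then have "dual_obj C b lam q \<ge> 2 * (z q \<bullet> y t) - y t \<bullet> y t"
      unfolding z_def by (rule dual_obj_ge[OF assms(2)])
    ultimately have "0 \<le> (z (w t) - z q) \<bullet> y t"
      by (simp add: inner_diff_left)
    also have "z (w t) - z q = - (lam * t) *\<^sub>R adjoint fin_diff (r - q)"
      by (simp add: z_def w_def linear_add[OF lin] linear_scale[OF lin] scaleR_add_right)
    finally have "(lam * t) * ((r - q) \<bullet> fin_diff (y t)) \<le> 0"
      by (simp add: inner_commute[of "adjoint _ _"] inner_adjoint_fin_diff inner_commute)
    then show ?thesis
      using assms(4) t(1) by (simp add: mult_le_0_iff zero_less_mult_iff not_less)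
  qed
  \<comment> \<open>The sign is known only for \<open>t > 0\<close>; continuity of the projection
    carries it to \<open>y 0\<close>, the projection belonging to \<open>q\<close>.\<close>
  have "continuous_on UNIV (\<lambda>t. (r - q) \<bullet> fin_diff (y t))"
    unfolding y_def z_def w_def
    by (intro continuous_intros linear_continuous_on_compose[OF _ linear_fin_diff]
        linear_continuous_on_compose[OF _ lin]
        continuous_on_compose2[OF continuous_on_closest_point[OF assms(3,2,1), of UNIV]]) auto
  then have "((\<lambda>t. (r - q) \<bullet> fin_diff (y t)) \<longlongrightarrow> (r - q) \<bullet> fin_diff (y 0)) (at_right 0)"
    by (auto simp: continuous_on_def intro: tendsto_within_subset)
  moreover have "\<forall>\<^sub>F t in at_right 0. (r - q) \<bullet> fin_diff (y t) \<le> 0"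
    using eventually_at_right_real[OF zero_less_one] by eventually_elim (auto intro: le)
  ultimately have "(r - q) \<bullet> fin_diff (y 0) \<le> 0"
    by (rule tendsto_upperbound) simp
  then show ?thesis
    by (simp add: y_def w_def z_def)
qed

text \<open>Testing first-order optimality against an \<open>r\<close> that attains the support
  function at \<open>fin_diff y\<close> gives one inequality; feasibility of \<open>q\<close> gives
  the other.\<close>

lemma dual_minimiser_tv1i:
  fixes b :: "('m::{finite,linorder}, 'n::{finite,linorder}) img"
  assumes "C \<noteq> {}" "closed C" "convex C" "lam > 0"
    and min: "is_arg_min (dual_obj C b lam) (\<lambda>q. q \<in> dual_feasible) q"
    and y: "y = closest_point C (b - lam *\<^sub>R adjoint fin_diff q)"
  shows "tv1i y = q \<bullet> fin_diff y"
proof -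
  obtain r where r: "r \<in> dual_feasible" "r \<bullet> fin_diff y = tv_fun (fin_diff y)"
    using tv_fun_attained[OF fin_diff_in_grad_space] .
  have "(r - q) \<bullet> fin_diff y \<le> 0"
    unfolding y using assms(1-5) r(1) by (rule dual_minimiser_first_order)
  moreover have "q \<bullet> fin_diff y \<le> tv_fun (fin_diff y)"
    using min by (intro inner_le_tv_fun fin_diff_in_grad_space) (simp add: is_arg_min_def)
  ultimately show ?thesis
    using r(2) by (simp add: tv1i_def inner_diff_left)
qed

text \<open>Replacing \<open>tv1i\<close> by its minorant \<open>q \<bullet> fin_diff _\<close>,
  exact at \<open>y\<close>, turns optimality of \<open>x\<close> into minimal distance to
  \<open>z\<close> within \<open>C\<close>, and nearest points are unique.\<close>

lemma primal_minimiser_eq_projection: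
  fixes b :: "('m::{finite,linorder}, 'n::{finite,linorder}) img"
  assumes "C \<noteq> {}" "closed C" "convex C" "lam > 0"
    and x: "is_arg_min (primal_obj C b lam) (\<lambda>x. True) x"
    and q: "is_arg_min (dual_obj C b lam) (\<lambda>q. q \<in> dual_feasible) q"
  shows "x = closest_point C (b - lam *\<^sub>R adjoint fin_diff q)"
proof -
  define z where "z = b - lam *\<^sub>R adjoint fin_diff q"
  define y where "y = closest_point C z"
  have y: "y \<in> C"
    unfolding y_def using assms(1,2) by (simp add: closest_point_in_set)
  have le: "primal_obj C b lam x \<le> primal_obj C b lam y"
    using x unfolding is_arg_min_linorder by blast
  \<comment> \<open>The objective is finite at \<open>y\<close>, hence also at the minimiser
    \<open>x\<close>.\<close>
  then have xC: "x \<in> C"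
    using y by (auto simp: primal_obj_def indicator_fun_def split: if_splits)
  have "(norm (x - b))\<^sup>2 + 2 * (lam * tv1i x) \<le> (norm (y - b))\<^sup>2 + 2 * (lam * tv1i y)"
    using le xC y by (simp add: primal_obj_def indicator_fun_def)
  also have "tv1i y = q \<bullet> fin_diff y"
    using assms(1-4) q by (rule dual_minimiser_tv1i) (simp add: y_def z_def)
  finally have "(norm (x - b))\<^sup>2 + 2 * (lam * tv1i x)
      \<le> (norm (y - b))\<^sup>2 + 2 * (lam * (q \<bullet> fin_diff y))" .
  moreover have "q \<bullet> fin_diff x \<le> tv1i x"
    unfolding tv1i_def using q
    by (intro inner_le_tv_fun fin_diff_in_grad_space) (simp add: is_arg_min_def)
  then have "lam * (q \<bullet> fin_diff x) \<le> lam * tv1i x"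
    using assms(4) by simp
  moreover have "(norm (v - b))\<^sup>2 + 2 * (lam * (q \<bullet> fin_diff v))
      = (norm (v - z))\<^sup>2 + (norm b)\<^sup>2 - (norm z)\<^sup>2" for v
    using norm_diff_square_complete[of v b "lam *\<^sub>R adjoint fin_diff q"]
    by (simp add: z_def inner_adjoint_fin_diff inner_commute)
  ultimately have "(norm (x - z))\<^sup>2 \<le> (norm (y - z))\<^sup>2"
    by (smt (verit))
  then have "dist z x \<le> dist z y"
    by (simp add: dist_norm norm_minus_commute)
  then have "dist z x \<le> dist z v" if "v \<in> C" for v
    using closest_point_le[OF assms(2) that, of z] unfolding y_def by linarith
  then show ?thesis
    using closest_point_unique[OF assms(3,2) xC] by (simp add: z_def)
qed

theorem proposition1:
  fixes C :: "('m::{finite,linorder}, 'n::{finite,linorder}) img set"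
    and b :: "('m, 'n) img" and lam :: real
  assumes "C \<noteq> {}" and "closed C" and "convex C" and "lam > 0"
  shows "(\<exists>a c :: real. a > 0 \<and>
            (\<forall>q\<in>dual_feasible. lagrange_dual_fun C b lam q = ereal (c - a * dual_obj C b lam q)) \<and>
            (\<forall>q\<in>grad_space - dual_feasible. lagrange_dual_fun C b lam q = - \<infinity>))
       \<and> (\<forall>x q. is_arg_min (primal_obj C b lam) (\<lambda>x. True) x \<longrightarrow>
                is_arg_min (dual_obj C b lam) (\<lambda>q. q \<in> dual_feasible) q \<longrightarrow>
                x = closest_point C (b - lam *\<^sub>R adjoint fin_diff q))"
proof (rule conjI)
  show "\<exists>a c :: real. a > 0 \<and>
      (\<forall>q\<in>dual_feasible. lagrange_dual_fun C b lam q = ereal (c - a * dual_obj C b lam q)) \<and>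
      (\<forall>q\<in>grad_space - dual_feasible. lagrange_dual_fun C b lam q = - \<infinity>)"
    using assms lagrange_dual_fun_feasible[OF assms(1,2,4)]
      lagrange_dual_fun_infeasible[OF assms(1,4)]
    \<comment> \<open>The factor stems from dividing the primal objective by \<open>lam\<close>, the
      additive constant from completing the square.\<close>
    by (intro exI[of _ "1 / (2 * lam)"] exI[of _ "(norm b)\<^sup>2 / (2 * lam)"]) simp
qed (use primal_minimiser_eq_projection[OF assms] in blast)

end
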